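(* Let $S$ be a $d\times d$ symmetric matrix over $\mathbb{Z}_2$ that is not parity indicative. Let $K\ge 2d-\operatorname{rank}(S)$ or, if $\operatorname{rank}(S)=d$ and $\operatorname{diag}(S)=\vec 0$, let $K\ge d+1$. Let $\alpha\in\mathbb{Z}_2^K$ be a nonzero vector such that $\|\alpha\|_0\equiv\operatorname{Tr}(S)\pmod 2$. Then there exists a $K$-element frame $\mathcal{F}=\{f_i\}_{i=1}^K$ for $\mathbb{Z}_2^d$ such that $S=\Theta_{\mathcal{F}}\Theta_{\mathcal{F}}^*$ and $(f_i,f_i)=\alpha[i]$ for every $i$ if and only if $\|\alpha\|_0\ne K$.
   Context: All vectors and matrices have entries in the two-element field $\mathbb{Z}_2$ and all operations (including rank and trace) are over $\mathbb{Z}_2$; $d\ge 1$. The dot product is $(a,b)=\sum_n a[n]b[n]$. A (binary) frame for $\mathbb{Z}_2^d$ is a finite sequence of vectors $\{f_j\}_{j=1}^K$ (repetitions and zero vectors allowed) whose span is $\mathbb{Z}_2^d$. Its synthesis operator $\Theta_{\mathcal{F}}$ is the $d\times K$ matrix whose $j$th column is $f_j$; $^*$ denotes transpose. $\|\alpha\|_0$ is the number of nonzero entries of $\alpha$; $\operatorname{diag}(S)$ is the vector of diagonal entries of $S$. A vector $v$ is even if $(v,v)=0$ (equivalently $\|v\|_0$ is even) and odd otherwise. A $d\times d$ symmetric matrix $S$ is parity indicative if, for every $1\le i\le d$, $S_{ii}=1$ if and only if the $i$th row of $S$ is odd. *)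

theory Defs
  imports "HOL-Analysis.Analysis" "HOL-Library.Z2"
begin

text \<open>
  The two-element field is the type \<open>bit\<close>.  The dimension of the space is \<open>CARD('d)\<close>, the number of
  frame vectors is \<open>CARD('k)\<close>, and the dot product is \<^const>\<open>scalar_product\<close>.
\<close>

definition norm0 :: "bit ^ 'n \<Rightarrow> nat"
  where "norm0 v = card {i. v $ i \<noteq> 0}"

definition diag :: "bit ^ 'd ^ 'd \<Rightarrow> bit ^ 'd"
  where "diag S = (\<chi> i. S $ i $ i)"

definition even_vec :: "bit ^ 'n \<Rightarrow> bool"
  where "even_vec v \<longleftrightarrow> scalar_product v v = 0"

abbreviation odd_vec :: "bit ^ 'n \<Rightarrow> bool"
  where "odd_vec v \<equiv> \<not> even_vec v"

text \<open>This notion is meant for symmetric matrices; symmetry is always assumed separately.\<close>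

definition parity_indicative :: "bit ^ 'd ^ 'd \<Rightarrow> bool"
  where "parity_indicative S \<longleftrightarrow> (\<forall>i. S $ i $ i = 1 \<longleftrightarrow> odd_vec (row i S))"

text \<open>
  A frame is a family, so repeated vectors and zero vectors are allowed.
\<close>

definition binary_frame :: "('k::finite \<Rightarrow> bit ^ 'd) \<Rightarrow> bool"
  where "binary_frame F \<longleftrightarrow> vec.span (range F) = UNIV"

definition synthesis :: "('k::finite \<Rightarrow> bit ^ 'd) \<Rightarrow> bit ^ 'k ^ 'd"
  where "synthesis F = (\<chi> i j. F j $ i)"

end

theory Submission
  imports Defs
begin

text \<open>
  Let \<open>r\<^sub>i\<close> be the rows of the synthesis matrix.  Then \<open>S\<close> is the Gram matrix of the \<open>r\<^sub>i\<close>, the family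
  of columns is a frame iff the \<open>r\<^sub>i\<close> are linearly independent, and the parities of the columns are
  the coordinates of \<open>\<Sum>\<^sub>i r\<^sub>i\<close>.  So a frame with the required properties is the same as an injective
  linear map \<open>\<phi>\<close> (sending the \<open>i\<close>th unit vector to \<open>r\<^sub>i\<close>) that carries the bilinear form
  \<open>(x, y) \<mapsto> x\<^sup>T S y\<close> to the dot product and the all-ones vector \<open>1\<close> to \<open>\<alpha>\<close>.

  The exclusion of \<open>\<alpha> = 1\<close> comes from the identity \<open>(x, x) = (x, 1)\<close>: the vector \<open>1\<close> is the
  characteristic vector of the dot product, whereas \<open>S\<close> is parity indicative exactly if \<open>1\<close> is a
  characteristic vector of the form of \<open>S\<close>.  An isometric \<open>\<phi>\<close> with \<open>\<phi> 1 = 1\<close> therefore forces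
  \<open>S\<close> to be parity indicative.

  Conversely, it is enough to find \<^emph>\<open>some\<close> isometric embedding \<open>\<phi>\<close>.  Its value \<open>\<phi> 1\<close> is neither \<open>0\<close>
  (injectivity) nor \<open>1\<close> (just explained), it has the same parity as \<open>\<alpha>\<close> because both are given by
  the trace of \<open>S\<close>, and the orthogonal group of the dot product acts transitively on the vectors of
  a given parity other than \<open>0\<close> and \<open>1\<close>, by at most two transvections (\<open>dot_isometry_transitive\<close>).

  To embed, suppose first that some diagonal entry of \<open>S\<close> is nonzero.  A largest orthonormal set \<open>T\<close>
  then spans a complement of the kernel of \<open>S\<close> (\<open>exists_full_orthonormal\<close>).  Each element of \<open>T\<close> is
  sent to a unit vector and each element of a basis of the kernel to a sum of two further unit
  vectors, which takes \<open>d + dim (ker S)\<close> coordinates (\<open>embedding_nonalternating\<close>).  If the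
  diagonal of \<open>S\<close> vanishes, one diagonal entry is switched to \<open>1\<close>; this form is embedded with one
  coordinate to spare, and that coordinate repairs the change (\<open>isometric_embedding_exists\<close>).
\<close>

text \<open>
  The default rewriting of sums and products in \<open>bit\<close> to bitwise operations would hide the field
  structure.
\<close>

declare add_bit_eq_xor [simp del] mult_bit_eq_and [simp del]

section \<open>The dot product and the form of a symmetric matrix\<close>

instance bit :: finite
proof
  have "(UNIV :: bit set) = {0, 1}"
    using bit_not_zero_iff by blast
  then show "finite (UNIV :: bit set)"
    by (metis finite.emptyI finite.insertI)
qed

abbreviation dot :: "bit ^ 'n \<Rightarrow> bit ^ 'n \<Rightarrow> bit"  (infix "\<odot>" 70)
  where "x \<odot> y \<equiv> scalar_product x y"

abbreviation lin :: "(bit ^ 'm \<Rightarrow> bit ^ 'n) \<Rightarrow> bool"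
  where "lin \<equiv> Vector_Spaces.linear (*s) (*s)"

lemma bit_self_add [simp]: "(a :: bit) + a = 0" "(a :: bit) + (a + b) = b"
  by (cases a; cases b; simp)+

lemma bit_self_mult [simp]: "(a :: bit) * a = a" "(a :: bit) * (a * b) = a * b"
  by (cases a; simp)+

lemma vec_bit_self_add [simp]: "(x :: bit ^ 'n) + x = 0"
  by (simp add: vec_eq_iff)

lemma dot_commute: "x \<odot> y = y \<odot> x"
  by (simp add: scalar_product_def mult.commute)

lemma dot_add_left [simp]: "(x + y) \<odot> z = x \<odot> z + y \<odot> z"
  and dot_add_right [simp]: "z \<odot> (x + y) = z \<odot> x + z \<odot> y"
  by (simp_all add: scalar_product_def algebra_simps sum.distrib)

lemma dot_zero_left [simp]: "0 \<odot> z = 0"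
  and dot_zero_right [simp]: "z \<odot> 0 = 0"
  by (simp_all add: scalar_product_def)

lemma dot_scale_left [simp]: "(c *s x) \<odot> z = c * (x \<odot> z)"
  and dot_scale_right [simp]: "z \<odot> (c *s x) = c * (z \<odot> x)"
  by (simp_all add: scalar_product_def sum_distrib_left algebra_simps)

lemma dot_sum_right: "z \<odot> (\<Sum>a\<in>A. f a) = (\<Sum>a\<in>A. z \<odot> f a)"
  by (induction A rule: infinite_finite_induct) auto

lemma dot_axis_left [simp]: "axis i 1 \<odot> x = x $ i"
  by (simp add: scalar_product_def axis_def if_distrib[of "\<lambda>a. a * _"] cong: if_cong)

lemma dot_axis_right [simp]: "x \<odot> axis i 1 = x $ i"
  by (metis dot_axis_left dot_commute)

text \<open>
  The vector \<open>1\<close> is characteristic for the dot product because \<open>a\<^sup>2 = a\<close> for bits.  Both directions of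
  the theorem rest on this; it also makes \<open>x \<mapsto> x \<odot> x\<close> linear.
\<close>

lemma dot_self: "x \<odot> x = x \<odot> 1"
  by (simp add: scalar_product_def)

lemma dot_self_norm0: "x \<odot> x = of_nat (norm0 x)"
proof -
  have "x \<odot> x = (\<Sum>i\<in>UNIV. if x $ i \<noteq> 0 then 1 else 0)"
    unfolding scalar_product_def by (intro sum.cong) auto
  also have "\<dots> = of_nat (norm0 x)"
    by (simp add: norm0_def flip: sum.inter_filter)
  finally show ?thesis .
qed

lemma norm0_full_iff: "norm0 \<alpha> = CARD('k) \<longleftrightarrow> \<alpha> = 1" for \<alpha> :: "bit ^ 'k"
proof
  assume full: "norm0 \<alpha> = CARD('k)"
  have "{i. \<alpha> $ i \<noteq> 0} = UNIV"
    by (rule card_subset_eq) (use full in \<open>simp_all only: norm0_def finite subset_UNIV\<close>)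
  then have "\<alpha> $ i \<noteq> 0" for i
    by blast
  then show "\<alpha> = 1" by (simp add: vec_eq_iff)
qed (simp add: norm0_def)

definition form :: "bit ^ 'd ^ 'd \<Rightarrow> bit ^ 'd \<Rightarrow> bit ^ 'd \<Rightarrow> bit"
  where "form S x y = x \<odot> (S *v y)"

lemma form_add [simp]: "form S (x + y) z = form S x z + form S y z"
    "form S x (y + z) = form S x y + form S x z"
  by (simp_all add: form_def matrix_vector_right_distrib)

lemma form_scale [simp]: "form S (c *s x) z = c * form S x z"
    "form S x (c *s z) = c * form S x z"
  by (simp_all add: form_def vector_scalar_commute)

lemma form_zero [simp]: "form S 0 z = 0" "form S x 0 = 0"
  by (simp_all add: form_def)

lemma form_sum: "form S z (\<Sum>a\<in>A. f a) = (\<Sum>a\<in>A. form S z (f a))"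
  by (induction A rule: infinite_finite_induct) auto

lemma form_axis: "form S (axis i 1) (axis j 1) = S $ i $ j"
  by (simp only: form_def dot_axis_left)
    (simp add: matrix_vector_mult_def axis_def if_distrib[of "(*) _"] cong: if_cong)

lemma form_commute:
  assumes "transpose S = S"
  shows "form S x y = form S y x"
proof -
  have S: "S $ i $ j = S $ j $ i" for i j
    by (metis assms transpose_def vec_lambda_beta)
  have "form S x y = (\<Sum>i\<in>UNIV. \<Sum>j\<in>UNIV. x $ i * S $ i $ j * y $ j)"
    by (simp add: form_def scalar_product_def matrix_vector_mult_def sum_distrib_left mult.assoc)
  also have "\<dots> = (\<Sum>j\<in>UNIV. \<Sum>i\<in>UNIV. x $ i * S $ i $ j * y $ j)"
    by (rule sum.swap)
  also have "\<dots> = form S y x"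
    by (simp add: form_def scalar_product_def matrix_vector_mult_def sum_distrib_left mult_ac S)
  finally show ?thesis .
qed

lemma form_nondeg: "(\<forall>y. form S y x = 0) \<longleftrightarrow> S *v x = 0"
proof
  assume "\<forall>y. form S y x = 0"
  then have "(S *v x) $ i = 0" for i
    by (metis dot_axis_left form_def)
  then show "S *v x = 0" by (simp add: vec_eq_iff)
qed (simp add: form_def)

lemma vec_sum_axis: "x = (\<Sum>i\<in>UNIV. x $ i *s axis i 1)" for x :: "bit ^ 'n"
  by (simp add: basis_expansion)

text \<open>
  For a symmetric \<open>S\<close> the quadratic map \<open>x \<mapsto> form S x x\<close> is additive, since polarization yields an
  even number of cross terms.  In particular the form is alternating iff \<open>S\<close> has zero diagonal, and
  its value at \<open>1\<close> is the trace.
\<close>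

lemma form_self:
  assumes "transpose S = S"
  shows "form S x x = (\<Sum>i\<in>UNIV. S $ i $ i * x $ i)"
proof -
  have "form S (\<Sum>i\<in>A. f i) (\<Sum>i\<in>A. f i) = (\<Sum>i\<in>A. form S (f i) (f i))" for A :: "'a set" and f
  proof (induction A rule: infinite_finite_induct)
    case (insert a A)
    \<comment> \<open>The two cross terms agree by symmetry, so they cancel.\<close>
    then show ?case
      using form_commute[OF assms, of "f a" "sum f A"] by (simp add: add_ac)
  qed auto
  from this[of "\<lambda>i. x $ i *s axis i 1" UNIV] show ?thesis
    by (simp add: form_axis mult_ac flip: vec_sum_axis)
qed

section \<open>Isometric embeddings\<close>

definition orthonormal :: "bit ^ 'd ^ 'd \<Rightarrow> (bit ^ 'd) set \<Rightarrow> bool"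
  where "orthonormal S T \<longleftrightarrow> (\<forall>s\<in>T. \<forall>t\<in>T. form S s t = (if s = t then 1 else 0))"

text \<open>In characteristic two, adding the orthogonal projection of \<open>x\<close> is the same as subtracting it.\<close>

lemma orthonormal_residual:
  assumes T: "orthonormal S T" and s: "s \<in> T"
  shows "form S s (x + (\<Sum>t\<in>T. form S t x *s t)) = 0"
proof -
  have "form S s (\<Sum>t\<in>T. form S t x *s t) = (\<Sum>t\<in>T. if s = t then form S t x else 0)"
    unfolding form_sum using T s by (intro sum.cong) (auto simp: orthonormal_def)
  then show ?thesis using s by simp
qed

text \<open>
  Take \<open>T\<close> orthonormal of largest size; it is nonempty because \<open>form S (axis i 1) (axis i 1) = 1\<close>.
  Everything orthogonal to \<open>T\<close> lies in the kernel of \<open>S\<close>.  Indeed, such an \<open>x\<close> has \<open>form S x x = 0\<close>,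
  or else it could join \<open>T\<close>.  And if \<open>x\<close>, \<open>y\<close> are orthogonal to \<open>T\<close> with \<open>form S x y = 1\<close>, then \<open>t \<in> T\<close>
  can be exchanged for the three vectors \<open>t + x\<close>, \<open>t + y\<close>, \<open>t + x + y\<close>: this is the isometry of a
  hyperbolic plane plus a unit vector with three orthogonal unit vectors.  Hence the form vanishes on
  the orthogonal complement of \<open>T\<close>, which together with \<open>T\<close> spans the space.
\<close>

lemma exists_full_orthonormal:
  fixes S :: "bit ^ 'd ^ 'd"
  assumes sym: "transpose S = S" and diag: "S $ i $ i \<noteq> 0"
  obtains T where "orthonormal S T" and "\<And>x. S *v (x + (\<Sum>t\<in>T. form S t x *s t)) = 0"
proof -
  note comm = form_commute[OF sym]
  have one: "orthonormal S {axis i 1}"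
    using diag by (simp add: orthonormal_def form_axis)
  have "card T' \<le> card (UNIV :: (bit ^ 'd) set)" for T' :: "(bit ^ 'd) set"
    by (rule card_mono) (rule finite, rule subset_UNIV)
  then have "\<exists>T. orthonormal S T \<and> (\<forall>T'. orthonormal S T' \<longrightarrow> card T' \<le> card T)"
    by (intro ex_has_greatest_nat[of "orthonormal S", OF one, of _ "Suc (card (UNIV :: (bit ^ 'd) set))"])
      (use le_imp_less_Suc in blast)
  then obtain T where T: "orthonormal S T" and max: "\<And>T'. orthonormal S T' \<Longrightarrow> card T' \<le> card T"
    by blast
  have finT: "finite T" by simp
  have "card T \<ge> 1" using max[OF one] by simp
  then obtain t where t: "t \<in> T" by (metis card.empty ex_in_conv not_one_le_zero)
  have perp: "form S x t = 0" if "\<forall>t\<in>T. form S t x = 0" "t \<in> T" for x t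
    using that comm by metis
  have alt: "form S x x = 0" if x: "\<forall>t\<in>T. form S t x = 0" for x
  proof (rule ccontr)
    assume "form S x x \<noteq> 0"
    then have "orthonormal S (insert x T)" and "x \<notin> T"
      using T x perp[OF x] by (auto simp: orthonormal_def)
    then show False using max finT by fastforce
  qed
  have iso: "form S x y = 0" if x: "\<forall>t\<in>T. form S t x = 0" and y: "\<forall>t\<in>T. form S t y = 0" for x y
  proof (rule ccontr)
    assume xy: "form S x y \<noteq> 0"
    let ?T = "insert (t + x) (insert (t + y) (insert (t + x + y) (T - {t})))"
    have xx: "form S x x = 0" "form S y y = 0" "form S x y = 1" "form S y x = 1"
      using alt x y xy comm[of x y] by auto
    have tt: "form S t t = 1" "form S t x = 0" "form S t y = 0" "form S x t = 0" "form S y t = 0"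
      using T t x y perp[OF x t] perp[OF y t] by (auto simp: orthonormal_def)
    have st: "form S s t = 0" "form S t s = 0" "form S s x = 0" "form S x s = 0"
        "form S s y = 0" "form S y s = 0" if "s \<in> T - {t}" for s
      using T t x y perp[OF x] perp[OF y] that by (auto simp: orthonormal_def)
    have neq: "x \<noteq> 0" "y \<noteq> 0" "x \<noteq> y"
      using xx by auto
    have new: "t + x \<notin> T - {t}" "t + y \<notin> T - {t}" "t + x + y \<notin> T - {t}"
      using st(2)[of "t + x"] st(2)[of "t + y"] st(2)[of "t + x + y"] tt by auto
    have "orthonormal S ?T"
      unfolding orthonormal_def
      using T xx tt st new neq by (auto simp: orthonormal_def)
    moreover have "card ?T = card T + 2"
    proof -
      have "card ?T = Suc (Suc (Suc (card (T - {t}))))"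
        using new neq finT by (simp add: card_insert_if)
      also have "Suc (card (T - {t})) = card T"
        using t finT by (metis card_Suc_Diff1)
      finally show ?thesis by simp
    qed
    ultimately show False using max by fastforce
  qed
  have "S *v (y + (\<Sum>t\<in>T. form S t y *s t)) = 0" (is "S *v ?x = 0") for y
  proof -
    have x: "\<forall>t\<in>T. form S t ?x = 0"
      using orthonormal_residual[OF T] by blast
    have "form S z ?x = 0" for z
    proof -
      let ?p = "\<Sum>t\<in>T. form S t z *s t"
      have "form S ?p ?x = 0"
        unfolding comm[of ?p] form_sum using perp[OF x] by (intro sum.neutral) simp
      moreover have "form S (z + ?p) ?x = 0"
        by (rule iso) (use x orthonormal_residual[OF T] in blast)+
      ultimately show ?thesis by (simp only: form_add(1) add_0_right)
    qed
    then show ?thesis using form_nondeg by blast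
  qed
  with T that show ?thesis by blast
qed

definition isometric_embedding :: "bit ^ 'd ^ 'd \<Rightarrow> (bit ^ 'd \<Rightarrow> bit ^ 'k) \<Rightarrow> bool"
  where "isometric_embedding S \<phi> \<longleftrightarrow>
    lin \<phi> \<and> inj \<phi> \<and> (\<forall>x y. \<phi> x \<odot> \<phi> y = form S x y)"

lemma lin_I:
  assumes "\<And>x y. f (x + y) = f x + f y" and "\<And>c x. f (c *s x) = c *s f x"
  shows "lin f"
  using assms by (simp add: Vector_Spaces.linear_iff vec.vector_space_axioms)

lemma lin_inj:
  assumes lin: "lin f" and zero: "\<And>x. f x = 0 \<Longrightarrow> x = 0"
  shows "inj f"
proof (rule injI)
  fix x y assume "f x = f y"
  then have "f (x - y) = 0" by (simp add: vec.linear_diff[OF lin])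
  then show "x = y" using zero by fastforce
qed

lemma lin_simps:
  assumes "lin f"
  shows "f (x + y) = f x + f y" "f (c *s x) = c *s f x" "f 0 = 0"
    "f (sum g A) = (\<Sum>a\<in>A. f (g a))"
  by (rule vec.linear_add[OF assms] vec.linear_scale[OF assms] vec.linear_0[OF assms]
      vec.linear_sum[OF assms])+

text \<open>
  A basis \<open>Z\<close> of the kernel and the set \<open>T\<close> of \<open>exists_full_orthonormal\<close> form a basis of the whole
  space.  The images \<open>e v 0 + e v 1\<close> of kernel vectors are even and have disjoint supports,
  so they are isotropic and mutually orthogonal.  Confining the image to a set \<open>J\<close> of coordinates
  leaves the remaining coordinates free for a later correction.
\<close>

lemma embedding_nonalternating:
  fixes S :: "bit ^ 'd ^ 'd" and J :: "'k::finite set"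
  assumes sym: "transpose S = S" and diag: "S $ i $ i \<noteq> 0"
    and card: "CARD('d) + vec.dim {x. S *v x = 0} \<le> card J"
  obtains \<phi> :: "bit ^ 'd \<Rightarrow> bit ^ 'k"
  where "isometric_embedding S \<phi>" and "\<forall>x. \<forall>k. k \<notin> J \<longrightarrow> \<phi> x $ k = 0"
proof -
  note comm = form_commute[OF sym]
  obtain T where T: "orthonormal S T" and ker: "\<And>x. S *v (x + (\<Sum>t\<in>T. form S t x *s t)) = 0"
    using exists_full_orthonormal[OF sym diag] by blast
  let ?R = "{x. S *v x = 0}"
  obtain Z where Z: "Z \<subseteq> ?R" "vec.independent Z" "?R \<subseteq> vec.span Z" "card Z = vec.dim ?R"
    using vec.basis_exists by blast
  have fin: "finite T" "finite Z" by simp_all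
  have Z0: "form S y z = 0" "form S z y = 0" if "z \<in> Z" for y z
    using that Z(1) comm[of z y] by (auto simp: form_def)
  have disj: "T \<inter> Z = {}"
    using T Z0 by (fastforce simp: orthonormal_def)
  have ind: "vec.independent (T \<union> Z)"
    unfolding vec.independent_explicit
  proof (intro conjI allI impI ballI)
    fix c v assume c: "(\<Sum>v\<in>T \<union> Z. c v *s v) = 0" and v: "v \<in> T \<union> Z"
    have cT: "c s = 0" if "s \<in> T" for s
    proof -
      have "0 = form S s (\<Sum>v\<in>T \<union> Z. c v *s v)" using c by simp
      also have "\<dots> = (\<Sum>v\<in>T \<union> Z. if s = v then c v else 0)"
        unfolding form_sum using T Z0 that disj
        by (intro sum.cong) (auto simp: orthonormal_def)
      finally show ?thesis using fin that by simp
    qed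
    have "(\<Sum>v\<in>Z. c v *s v) = (\<Sum>v\<in>T \<union> Z. c v *s v)"
      using cT fin by (intro sum.mono_neutral_left) auto
    then have "c z = 0" if "z \<in> Z" for z
      using c Z(2) that by (simp add: vec.independent_explicit)
    then show "c v = 0" using cT v by blast
  qed simp
  have span: "vec.span (T \<union> Z) = UNIV"
  proof (rule UNIV_eq_I[symmetric])
    fix x
    define p where "p = (\<Sum>s\<in>T. form S s x *s s)"
    have "S *v (x + p) = 0" unfolding p_def by (rule ker)
    then have "x + p \<in> vec.span (T \<union> Z)"
      using Z(3) vec.span_mono[of Z "T \<union> Z"] by blast
    moreover have "p \<in> vec.span (T \<union> Z)"
      unfolding p_def by (intro vec.span_sum vec.span_scale vec.span_base) auto
    ultimately have "(x + p) + p \<in> vec.span (T \<union> Z)" by (rule vec.span_add)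
    then show "x \<in> vec.span (T \<union> Z)" by (simp add: add.assoc)
  qed
  have cardTZ: "card T + card Z \<le> CARD('d)"
    using vec.independent_card_le_dim[OF subset_UNIV ind] card_Un_disjoint[OF fin disj]
    by (simp only: vec_dim_card)
  \<comment> \<open>A label \<open>(v, n)\<close> stands for the \<open>n\<close>th coordinate reserved for the basis vector \<open>v\<close>.\<close>
  let ?D = "(T \<union> Z) \<times> {0::nat} \<union> Z \<times> {1}"
  have "card ?D = card T + card Z + card Z"
    using fin disj by (subst card_Un_disjoint) (auto simp: card_Un_disjoint)
  also have "\<dots> \<le> card J" using cardTZ card Z(4) by linarith
  finally obtain g where g: "g ` ?D \<subseteq> J" "inj_on g ?D"
    using card_le_inj[of ?D J] fin by auto
  define e :: "bit ^ 'd \<Rightarrow> nat \<Rightarrow> bit ^ 'k" where "e v n = axis (g (v, n)) 1" for v n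
  define f where "f v = (if v \<in> T then e v 0 else e v 0 + e v 1)" for v
  obtain \<phi> where lin: "lin \<phi>" and \<phi>: "\<And>v. v \<in> T \<union> Z \<Longrightarrow> \<phi> v = f v"
    using vec.linear_independent_extend[OF ind, of f] by blast
  note simps = lin_simps[OF lin]
  have e: "e u m \<odot> e v n = (if u = v \<and> m = n then 1 else 0)"
    if "(u, m) \<in> ?D" "(v, n) \<in> ?D" for u v m n
    using inj_onD[OF g(2) _ that] by (auto simp: e_def) (auto simp: axis_def)
  have ff: "f u \<odot> f v = form S u v" if "u \<in> T \<union> Z" "v \<in> T \<union> Z" for u v
    using that T Z0 disj by (auto simp: f_def e orthonormal_def)
  have fix1: "\<phi> x \<odot> f v = form S x v" if v: "v \<in> T \<union> Z" for x v
  proof -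
    have "x \<in> vec.span (T \<union> Z)" using span by simp
    then show ?thesis
      by (induction rule: vec.span_induct_alt) (simp_all add: simps \<phi> ff[OF _ v])
  qed
  have isom: "\<phi> x \<odot> \<phi> y = form S x y" for x y
  proof -
    have "y \<in> vec.span (T \<union> Z)" using span by simp
    then show ?thesis
      by (induction rule: vec.span_induct_alt) (simp_all add: simps \<phi> fix1)
  qed
  have supp: "\<phi> x $ k = 0" if k: "k \<notin> J" for x k
  proof -
    have ek: "e v n $ k = 0" if "(v, n) \<in> ?D" for v n
    proof -
      have "g (v, n) \<in> J" using that g(1) by blast
      then have "k \<noteq> g (v, n)" using k by blast
      then show ?thesis by (simp add: e_def axis_def)
    qed
    have fk: "f v $ k = 0" if "v \<in> T \<union> Z" for v
      using that ek[of v 0] ek[of v 1] by (auto simp: f_def)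
    have "x \<in> vec.span (T \<union> Z)" using span by simp
    then show ?thesis
      by (induction rule: vec.span_induct_alt) (simp_all add: simps \<phi> fk)
  qed
  \<comment> \<open>Isometry puts a vector with zero image into the kernel; there \<open>e z 0\<close> reads off its coordinate at \<open>z\<close>.\<close>
  have "x = 0" if x: "\<phi> x = 0" for x
  proof -
    have "S *v x = 0" using isom[of _ x] x form_nondeg[of S x] by simp
    then have "x \<in> vec.span Z" using Z(3) by blast
    then obtain c where c: "x = (\<Sum>z\<in>Z. c z *s z)"
      using vec.span_finite[of Z] fin by auto
    have "c z = 0" if z: "z \<in> Z" for z
    proof -
      have "0 = e z 0 \<odot> \<phi> x" using x by simp
      also have "\<dots> = (\<Sum>v\<in>Z. if z = v then c v else 0)"
        unfolding c simps dot_sum_right using z disj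
        by (intro sum.cong) (auto simp: \<phi> f_def e)
      finally show ?thesis using z fin by simp
    qed
    then show ?thesis using c by simp
  qed
  then have "inj \<phi>"
    by (rule lin_inj[OF lin])
  with lin isom supp that show ?thesis
    unfolding isometric_embedding_def by blast
qed

text \<open>
  In the alternating case let \<open>S'\<close> arise from \<open>S\<close> by setting the diagonal entry at \<open>i\<close> to \<open>1\<close>, so that
  \<open>form S' x y = form S x y + x\<^sub>i y\<^sub>i\<close>.  If \<open>\<psi>\<close> embeds \<open>S'\<close> without using the coordinate \<open>k\<close>, then
  \<open>x \<mapsto> \<psi> x + x\<^sub>i e\<^sub>k\<close> embeds \<open>S\<close>.  The kernel of \<open>S'\<close> consists of the \<open>x\<close> in the kernel of \<open>S\<close> with
  \<open>x\<^sub>i = 0\<close>.  If the kernel of \<open>S\<close> is nonzero, choosing \<open>i\<close> in the support of one of its vectors makes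
  the kernel smaller, which pays for the coordinate \<open>k\<close>; otherwise the strict inequality in the
  assumption \<open>alternating\<close> does.
\<close>

lemma isometric_embedding_exists:
  fixes S :: "bit ^ 'd ^ 'd"
  assumes sym: "transpose S = S"
    and dim: "CARD('d) + vec.dim {x. S *v x = 0} \<le> CARD('k)"
    and alternating: "diag S = 0 \<Longrightarrow> CARD('d) < CARD('k)"
  obtains \<phi> :: "bit ^ 'd \<Rightarrow> bit ^ 'k" where "isometric_embedding S \<phi>"
proof (cases "diag S = 0")
  case False
  then obtain i where i: "S $ i $ i \<noteq> 0"
    by (auto simp: diag_def vec_eq_iff)
  show ?thesis
    by (rule embedding_nonalternating[OF sym i dim]) (rule that)
next
  case True
  let ?R = "{x. S *v x = 0}"
  obtain i where i: "?R \<subseteq> {0} \<or> (\<exists>z\<in>?R. z $ i \<noteq> 0)"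
  proof (cases "?R \<subseteq> {0}")
    case False
    then obtain z where "z \<in> ?R" "z \<noteq> 0" by blast
    then show ?thesis using that by (metis vec_eq_iff zero_index)
  qed (use that in blast)
  define S' where "S' = (\<chi> a b. S $ a $ b + (if a = i \<and> b = i then 1 else 0))"
  have S': "S' *v x = S *v x + (x $ i) *s axis i 1" for x
  proof -
    have "(\<Sum>b\<in>UNIV. (S $ a $ b + (if a = i \<and> b = i then 1 else 0)) * x $ b)
        = (\<Sum>b\<in>UNIV. S $ a $ b * x $ b) + (\<Sum>b\<in>UNIV. if b = i then (if a = i then x $ b else 0) else 0)" for a
      unfolding sum.distrib[symmetric] by (intro sum.cong) (auto simp: algebra_simps)
    then show ?thesis
      by (simp add: S'_def vec_eq_iff matrix_vector_mult_def axis_def)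
  qed
  have sym': "transpose S' = S'"
    using sym by (auto simp: S'_def transpose_def vec_eq_iff)
  have diag0: "S $ j $ j = 0" for j
    using True by (simp add: diag_def vec_eq_iff)
  have diag': "S' $ i $ i \<noteq> 0"
    by (simp add: S'_def diag0)
  have form': "form S' x y = form S x y + x $ i * y $ i" for x y
    by (simp add: form_def S' mult.commute)
  let ?R' = "{x. S' *v x = 0}"
  have R': "?R' \<subseteq> {x \<in> ?R. x $ i = 0}"
  proof
    fix x assume "x \<in> ?R'"
    then have x: "S' *v x = 0" by simp
    have "form S x x = 0"
      unfolding form_self[OF sym] by (simp add: diag0)
    then have "x $ i = 0"
      using form'[of x x] x by (simp add: form_def)
    then show "x \<in> {x \<in> ?R. x $ i = 0}"
      using x S'[of x] by simp
  qed
  fix k :: 'k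
  have "CARD('d) + vec.dim ?R' \<le> CARD('k) - 1"
    using i
  proof
    assume "?R \<subseteq> {0}"
    then have "vec.dim ?R' = 0" using R' by auto
    then show ?thesis using alternating[OF True] by linarith
  next
    assume "\<exists>z\<in>?R. z $ i \<noteq> 0"
    then have "?R' \<subset> ?R" using R' by blast
    moreover have "vec.span {x. A *v x = 0} = {x. A *v x = 0}" for A :: "bit ^ 'd ^ 'd"
      by (intro vec.span_eq_iff[THEN iffD2] vec.subspaceI)
        (auto simp: matrix_vector_right_distrib vector_scalar_commute)
    ultimately have "vec.dim ?R' < vec.dim ?R"
      by (intro vec.dim_psubset) (simp only:)
    then show ?thesis using dim by linarith
  qed
  then have J: "CARD('d) + vec.dim ?R' \<le> card (UNIV - {k})"
    by (simp only: card_Diff_singleton[OF UNIV_I])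
  obtain \<psi> :: "bit ^ 'd \<Rightarrow> bit ^ 'k"
    where \<psi>: "isometric_embedding S' \<psi>" and supp: "\<forall>x. \<forall>l. l \<notin> UNIV - {k} \<longrightarrow> \<psi> x $ l = 0"
    by (rule embedding_nonalternating[OF sym' diag' J])
  have k: "\<psi> x $ k = 0" for x
    using supp by blast
  have lin: "lin \<psi>" and inj: "inj \<psi>" and isom: "\<And>x y. \<psi> x \<odot> \<psi> y = form S' x y"
    using \<psi> by (auto simp: isometric_embedding_def)
  define \<phi> where "\<phi> x = \<psi> x + (x $ i) *s axis k 1" for x
  have "lin \<phi>"
    by (intro lin_I) (simp_all add: \<phi>_def lin_simps[OF lin] vector_add_ldistrib
        vector_sadd_rdistrib add_ac vector_smult_assoc)
  moreover have "\<phi> x \<odot> \<phi> y = form S x y" for x y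
    using k[of x] k[of y] by (simp add: \<phi>_def isom form' axis_nth add_ac)
  moreover have "inj \<phi>"
  proof (rule lin_inj)
    fix x assume "\<phi> x = 0"
    then have zero: "\<phi> x $ l = 0" for l
      by simp
    have "\<psi> x $ l = 0" for l
      using zero[of l] k[of x] by (cases "l = k") (auto simp: \<phi>_def axis_def)
    then have "\<psi> x = \<psi> 0"
      by (simp add: vec_eq_iff lin_simps(3)[OF lin])
    then show "x = 0" using inj by (simp only: inj_eq)
  qed fact
  ultimately show ?thesis
    using that unfolding isometric_embedding_def by blast
qed

section \<open>Transitivity of the orthogonal group\<close>

definition dot_isometry :: "(bit ^ 'n \<Rightarrow> bit ^ 'n) \<Rightarrow> bool"
  where "dot_isometry g \<longleftrightarrow> lin g \<and> (\<forall>x y. g x \<odot> g y = x \<odot> y)"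

lemma dot_isometry_compose:
  "dot_isometry g \<Longrightarrow> dot_isometry h \<Longrightarrow> dot_isometry (g \<circ> h)"
  unfolding dot_isometry_def by (auto intro: Vector_Spaces.linear_compose)

lemma isometric_embedding_compose:
  assumes g: "dot_isometry g" and \<phi>: "isometric_embedding S \<phi>"
  shows "isometric_embedding S (g \<circ> \<phi>)"
proof -
  have "inj g"
  proof (rule injI)
    fix x y assume "g x = g y"
    then have "x \<odot> axis i 1 = y \<odot> axis i 1" for i
      using g unfolding dot_isometry_def by metis
    then show "x = y" by (simp add: vec_eq_iff)
  qed
  then show ?thesis
    using g \<phi> unfolding dot_isometry_def isometric_embedding_def
    by (auto intro: Vector_Spaces.linear_compose inj_compose)
qed

lemma transvection_dot:
  assumes "u \<odot> u = 0"
  shows "(x + (x \<odot> u) *s u) \<odot> (y + (y \<odot> u) *s u) = x \<odot> y"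
  using assms by (simp add: dot_commute[of u y] mult.commute add.assoc)

text \<open>
  The transvection along \<open>u = a + b\<close>, which is even, adds \<open>u\<close> to every vector that is not orthogonal
  to \<open>u\<close>; the second assumption says that \<open>a\<close> is such a vector.
\<close>

lemma transvection_maps:
  assumes "a \<odot> a = b \<odot> b" and "a \<odot> b \<noteq> a \<odot> a"
  shows "\<exists>g. dot_isometry g \<and> g a = b"
proof (intro exI conjI)
  let ?u = "a + b"
  let ?g = "\<lambda>x. x + (x \<odot> ?u) *s ?u"
  have u: "?u \<odot> ?u = 0"
    using assms(1) dot_commute[of a b] by (simp add: add_ac)
  have "lin ?g"
    by (intro lin_I) (simp_all only: dot_add_left dot_scale_left vector_add_ldistrib
        vector_sadd_rdistrib add_ac vector_smult_assoc)
  moreover have "?g x \<odot> ?g y = x \<odot> y" for x y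
    by (rule transvection_dot[OF u])
  ultimately show "dot_isometry ?g" by (simp add: dot_isometry_def)
  have "a \<odot> ?u = 1"
    using assms(2) by (cases "a \<odot> a"; cases "a \<odot> b") simp_all
  then show "?g a = b" by (simp add: add.assoc[symmetric])
qed

text \<open>
  If no single transvection takes \<open>a\<close> to \<open>b\<close>, then two do, via a vector \<open>c\<close> of the same parity to
  which the preceding lemma applies on both sides.  Such a \<open>c\<close> can be chosen of weight at most three.
\<close>

lemma dot_isometry_transitive:
  assumes self: "a \<odot> a = b \<odot> b" and a: "a \<noteq> 0" "a \<noteq> 1" and b: "b \<noteq> 0" "b \<noteq> 1"
  shows "\<exists>g. dot_isometry g \<and> g a = b"
proof (cases "a \<odot> b = a \<odot> a")
  case False
  then show ?thesis using transvection_maps self by blast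
next
  case ab: True
  have "\<exists>c. c \<odot> c = a \<odot> a \<and> c \<odot> a \<noteq> a \<odot> a \<and> c \<odot> b \<noteq> a \<odot> a"
  proof -
    \<comment> \<open>The supports of \<open>a\<close> and \<open>b\<close> either meet without covering all coordinates, or are incomparable.\<close>
    have overlap: "(\<exists>x y. a $ x = 1 \<and> b $ x = 1 \<and> a $ y = 0 \<and> b $ y = 0) \<or>
        (\<exists>y z. a $ y = 1 \<and> b $ y = 0 \<and> a $ z = 0 \<and> b $ z = 1)"
    proof -
      obtain p q r s where "a $ p = 1" "a $ q = 0" "b $ r = 1" "b $ s = 0"
        using a b by (auto simp: vec_eq_iff)
      then show ?thesis
        by (cases "b $ p"; cases "b $ q"; cases "a $ r"; cases "a $ s"; blast)
    qed
    have ax: "axis i 1 $ j = (if i = j then 1 else 0 :: bit)" for i j :: 'a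
      by (simp add: axis_def)
    show ?thesis
    proof (cases "a \<odot> a")
      \<comment> \<open>Here \<open>c\<close> must be even and meet both supports in an odd number of coordinates.\<close>
      case zero
      from overlap show ?thesis
      proof (elim disjE exE conjE)
        fix x y assume "a $ x = 1" "b $ x = 1" "a $ y = 0" "b $ y = 0"
        then show ?thesis
          using zero by (intro exI[of _ "axis x 1 + axis y 1"]) (auto simp: ax)
      next
        fix y z assume "a $ y = 1" "b $ y = 0" "a $ z = 0" "b $ z = 1"
        then show ?thesis
          using zero by (intro exI[of _ "axis y 1 + axis z 1"]) (auto simp: ax)
      qed
    next
      \<comment> \<open>Here \<open>c\<close> must be odd and meet both supports in an even number of coordinates.\<close>
      case one
      have "\<exists>x. a $ x * b $ x \<noteq> 0"
      proof (rule ccontr)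
        assume "\<not> ?thesis"
        then have "a \<odot> b = 0"
          unfolding scalar_product_def by (intro sum.neutral) blast
        then show False using ab one by simp
      qed
      then obtain x where x: "a $ x = 1" "b $ x = 1" by auto
      show ?thesis
      proof (cases "\<exists>y. a $ y = 0 \<and> b $ y = 0")
        case True
        then obtain y where "a $ y = 0" "b $ y = 0" by blast
        then show ?thesis
          using one by (intro exI[of _ "axis y 1"]) (auto simp: ax)
      next
        case False
        with overlap obtain y z where "a $ y = 1" "b $ y = 0" "a $ z = 0" "b $ z = 1" by blast
        moreover from this x have "x \<noteq> y" "x \<noteq> z" "y \<noteq> z" by auto
        ultimately show ?thesis
          using one x by (intro exI[of _ "axis x 1 + axis y 1 + axis z 1"]) (auto simp: ax)
      qed
    qed
  qed
  then obtain c where c: "c \<odot> c = a \<odot> a" "c \<odot> a \<noteq> a \<odot> a" "c \<odot> b \<noteq> a \<odot> a" by blast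
  obtain g where g: "dot_isometry g" "g a = c"
    using transvection_maps[of a c] c dot_commute[of a c] by auto
  obtain h where h: "dot_isometry h" "h c = b"
    using transvection_maps[of c b] c self by auto
  have "dot_isometry (h \<circ> g) \<and> (h \<circ> g) a = b"
    using g h dot_isometry_compose by auto
  then show ?thesis by blast
qed

section \<open>Frames with prescribed parities\<close>

text \<open>
  Extend a basis \<open>Z\<close> of the kernel to a basis \<open>B\<close> of the space: the columns of \<open>S\<close> lie in the span of the
  images of \<open>B - Z\<close>.  By symmetry these columns are the rows, whose span defines the rank.
\<close>

lemma rank_nullity_symmetric_le:
  fixes S :: "'a::field ^ 'd ^ 'd"
  assumes sym: "transpose S = S"
  shows "rank S + vec.dim {x. S *v x = 0} \<le> CARD('d)"
proof -
  let ?R = "{x. S *v x = 0}"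
  obtain Z where Z: "Z \<subseteq> ?R" "vec.independent Z" "?R \<subseteq> vec.span Z" "card Z = vec.dim ?R"
    by (rule vec.basis_exists)
  obtain B where B: "Z \<subseteq> B" "B \<subseteq> UNIV" "vec.independent B" "UNIV \<subseteq> vec.span B"
    by (rule vec.maximal_independent_subset_extend[OF subset_UNIV Z(2)])
  have fin: "finite B"
    by (rule vec.finiteI_independent[OF B(3)])
  have image: "S *v x \<in> vec.span ((*v) S ` (B - Z))" for x
  proof -
    have "x \<in> vec.span B" using B(4) by blast
    then show ?thesis
    proof (induction rule: vec.span_induct_alt)
      case (step c b y)
      have "S *v b \<in> vec.span ((*v) S ` (B - Z))"
      proof (cases "b \<in> Z")
        case True
        then have "S *v b = 0" using Z(1) by blast
        then show ?thesis using vec.span_zero by simp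
      next
        case False
        then show ?thesis using step.hyps(1) by (intro vec.span_base) blast
      qed
      then show ?case
        using step.IH
        by (simp add: matrix_vector_right_distrib vector_scalar_commute vec.span_add vec.span_scale)
    qed (simp add: vec.span_zero)
  qed
  have "row i S = S *v axis i 1" for i
    by (subst sym[symmetric]) (simp add: row_def transpose_def matrix_vector_mult_def axis_def
        if_distrib[of "(*) _"] cong: if_cong)
  then have "rows S \<subseteq> vec.span ((*v) S ` (B - Z))"
    using image by (auto simp: rows_def)
  then have "rank S \<le> card ((*v) S ` (B - Z))"
    unfolding row_rank_def_gen by (rule vec.dim_le_card) (use fin in blast)
  also have "\<dots> \<le> card (B - Z)"
    by (rule card_image_le) (use fin in blast)
  finally have "rank S \<le> card B - card Z"
    using B(1) fin by (simp add: card_Diff_subset finite_subset)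
  moreover have "card B \<le> CARD('d)"
    using vec.independent_card_le_dim[OF B(2,3)] by (simp only: vec_dim_card)
  moreover have "card Z \<le> card B"
    using B(1) fin by (intro card_mono) auto
  ultimately show ?thesis using Z(4) by linarith
qed

lemma mult_one_vec: "(S *v 1) $ i = (\<Sum>j\<in>UNIV. S $ i $ j)" for S :: "bit ^ 'n ^ 'm"
  by (simp add: matrix_vector_mult_def)

lemma bit_eq_iff_one: "(a :: bit) = b \<longleftrightarrow> (a = 1 \<longleftrightarrow> b = 1)"
  by (cases a; cases b) simp_all

text \<open>
  Parity indicativity says that \<open>form S v v = form S v 1\<close> for all unit vectors \<open>v\<close>.
\<close>

lemma parity_indicative_iff: "parity_indicative S \<longleftrightarrow> (\<forall>i. S $ i $ i = (S *v 1) $ i)"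
proof -
  have "row i S \<odot> row i S = (S *v 1) $ i" for i
    by (subst dot_self) (simp add: scalar_product_def row_def mult_one_vec)
  then show ?thesis
    unfolding parity_indicative_def even_vec_def
    by (subst bit_eq_iff_one) simp
qed

lemma gram_entry: "(synthesis F ** transpose (synthesis F)) $ i $ j = (\<Sum>k\<in>UNIV. F k $ i * F k $ j)"
  by (simp add: synthesis_def matrix_matrix_mult_def transpose_def)

lemma all_odd_parity_indicative:
  assumes "\<And>k. F k \<odot> F k = 1"
  shows "parity_indicative (synthesis F ** transpose (synthesis F))"
  unfolding parity_indicative_iff
proof
  fix i
  have one: "(\<Sum>j\<in>UNIV. F k $ j) = 1" for k
    using assms[of k] by (simp add: scalar_product_def)
  have "((synthesis F ** transpose (synthesis F)) *v 1) $ i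
      = (\<Sum>k\<in>UNIV. \<Sum>j\<in>UNIV. F k $ i * F k $ j)"
    unfolding mult_one_vec gram_entry by (rule sum.swap)
  also have "\<dots> = (\<Sum>k\<in>UNIV. F k $ i)"
    by (simp add: one flip: sum_distrib_left)
  finally show "(synthesis F ** transpose (synthesis F)) $ i $ i
      = ((synthesis F ** transpose (synthesis F)) *v 1) $ i"
    by (simp add: gram_entry)
qed

lemma one_vec_sum_axis: "(1 :: bit ^ 'n) = (\<Sum>i\<in>UNIV. axis i 1)"
  by (simp add: vec_eq_iff axis_def)

text \<open>
  The rows of the matrix of \<open>\<phi>\<close> are the columns of the synthesis matrix.  They span because
  injectivity provides a left inverse of the matrix of \<open>\<phi>\<close>.
\<close>

lemma frame_of_isometric_embedding:
  fixes \<phi> :: "bit ^ 'd \<Rightarrow> bit ^ 'k"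
  assumes \<phi>: "isometric_embedding S \<phi>"
  defines "F \<equiv> \<lambda>k. row k (matrix \<phi>)"
  shows "binary_frame F" and "S = synthesis F ** transpose (synthesis F)"
    and "F k \<odot> F k = \<phi> 1 $ k"
proof -
  have lin: "lin \<phi>" and inj: "inj \<phi>" and isom: "\<And>x y. \<phi> x \<odot> \<phi> y = form S x y"
    using \<phi> by (auto simp: isometric_embedding_def)
  have F: "F k $ i = \<phi> (axis i 1) $ k" for k i
    by (simp add: F_def row_def matrix_def)
  have "inj ((*v) (matrix \<phi>))"
    using inj by (simp add: inj_def matrix_works[OF lin])
  then have "\<exists>B. transpose (matrix \<phi>) ** B = mat 1"
    unfolding right_invertible_transpose matrix_left_invertible_injective .
  then have "vec.span (columns (transpose (matrix \<phi>))) = UNIV"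
    by (simp only: matrix_right_invertible_span_columns)
  moreover have "columns (transpose (matrix \<phi>)) = range F"
    by (auto simp: rows_def F_def)
  ultimately show "binary_frame F"
    by (simp add: binary_frame_def)
  show "S = synthesis F ** transpose (synthesis F)"
  proof -
    have "(synthesis F ** transpose (synthesis F)) $ i $ j = \<phi> (axis i 1) \<odot> \<phi> (axis j 1)" for i j
      by (simp add: gram_entry F scalar_product_def)
    then show ?thesis
      by (simp add: vec_eq_iff isom form_axis)
  qed
  have "F k \<odot> F k = (\<Sum>i\<in>UNIV. \<phi> (axis i 1) $ k)"
    by (simp add: scalar_product_def F)
  also have "\<dots> = \<phi> 1 $ k"
    unfolding one_vec_sum_axis lin_simps[OF lin] by simp
  finally show "F k \<odot> F k = \<phi> 1 $ k" .
qed

theorem theorem4p17: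
  fixes S :: "bit ^ 'd ^ 'd" and \<alpha> :: "bit ^ 'k"
  assumes "transpose S = S"
    and "\<not> parity_indicative S"
    and "if rank S = CARD('d) \<and> diag S = 0 then CARD('k) \<ge> CARD('d) + 1
         else CARD('k) \<ge> 2 * CARD('d) - rank S"
    and "\<alpha> \<noteq> 0"
    and "of_nat (norm0 \<alpha>) = trace S"
  shows "(\<exists>F :: 'k \<Rightarrow> bit ^ 'd. binary_frame F \<and>
            S = synthesis F ** transpose (synthesis F) \<and>
            (\<forall>i. scalar_product (F i) (F i) = \<alpha> $ i))
         \<longleftrightarrow> norm0 \<alpha> \<noteq> CARD('k)"
  unfolding norm0_full_iff
proof
  assume "\<exists>F :: 'k \<Rightarrow> bit ^ 'd. binary_frame F \<and>
            S = synthesis F ** transpose (synthesis F) \<and>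
            (\<forall>i. scalar_product (F i) (F i) = \<alpha> $ i)"
  then obtain F :: "'k \<Rightarrow> bit ^ 'd"
    where S: "S = synthesis F ** transpose (synthesis F)" and F: "\<forall>i. F i \<odot> F i = \<alpha> $ i"
    by (elim exE conjE)
  show "\<alpha> \<noteq> 1"
  proof
    assume "\<alpha> = 1"
    then have "parity_indicative S"
      unfolding S by (intro all_odd_parity_indicative) (simp add: F)
    then show False using assms(2) by contradiction
  qed
next
  assume \<alpha>: "\<alpha> \<noteq> 1"
  have nullity: "rank S + vec.dim {x. S *v x = 0} \<le> CARD('d)"
    by (rule rank_nullity_symmetric_le) fact
  have dim: "CARD('d) + vec.dim {x. S *v x = 0} \<le> CARD('k)"
  proof (cases "rank S = CARD('d) \<and> diag S = 0")
    case True
    then have "CARD('d) + 1 \<le> CARD('k)" using assms(3) by simp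
    then show ?thesis using True nullity by linarith
  next
    case False
    then have "2 * CARD('d) - rank S \<le> CARD('k)" using assms(3) by simp
    then show ?thesis using nullity by linarith
  qed
  have alternating: "CARD('d) < CARD('k)" if "diag S = 0"
  proof (cases "rank S = CARD('d)")
    case True
    then show ?thesis using that assms(3) by simp
  next
    case False
    then have "2 * CARD('d) - rank S \<le> CARD('k)" using assms(3) by simp
    then show ?thesis using False nullity by linarith
  qed
  obtain \<phi> :: "bit ^ 'd \<Rightarrow> bit ^ 'k" where \<phi>: "isometric_embedding S \<phi>"
    by (rule isometric_embedding_exists[OF assms(1) dim alternating])
  then have lin: "lin \<phi>" and inj: "inj \<phi>" and isom: "\<And>x y. \<phi> x \<odot> \<phi> y = form S x y"
    by (auto simp: isometric_embedding_def)
  \<comment> \<open>The image of \<open>1\<close> lies in the same orbit of the orthogonal group as \<open>\<alpha>\<close>.\<close>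
  have "\<phi> 1 \<odot> \<phi> 1 = trace S"
    unfolding isom by (simp add: form_self[OF assms(1)] trace_def)
  then have "\<phi> 1 \<odot> \<phi> 1 = \<alpha> \<odot> \<alpha>"
    by (simp only: dot_self_norm0 assms(5))
  moreover have "\<phi> 1 \<noteq> 0"
    using inj_eq[OF inj, of 1 0] lin_simps(3)[OF lin] by simp
  moreover have "\<phi> 1 \<noteq> 1"
  proof
    assume one: "\<phi> 1 = 1"
    have "S $ i $ i = (S *v 1) $ i" for i
    proof -
      have "S $ i $ i = \<phi> (axis i 1) \<odot> \<phi> (axis i 1)"
        by (simp add: isom form_axis)
      also have "\<dots> = \<phi> (axis i 1) \<odot> \<phi> 1"
        unfolding one by (rule dot_self)
      also have "\<dots> = (S *v 1) $ i"
        by (simp add: isom form_def)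
      finally show ?thesis .
    qed
    then show False using assms(2) parity_indicative_iff by blast
  qed
  ultimately obtain g where g: "dot_isometry g" "g (\<phi> 1) = \<alpha>"
    using dot_isometry_transitive[of "\<phi> 1" \<alpha>] assms(4) \<alpha> by blast
  have "isometric_embedding S (g \<circ> \<phi>)"
    using g(1) \<phi> by (rule isometric_embedding_compose)
  then show "\<exists>F :: 'k \<Rightarrow> bit ^ 'd. binary_frame F \<and>
            S = synthesis F ** transpose (synthesis F) \<and>
            (\<forall>i. scalar_product (F i) (F i) = \<alpha> $ i)"
    using frame_of_isometric_embedding[of S "g \<circ> \<phi>"] g(2)
    by (intro exI[of _ "\<lambda>k. row k (matrix (g \<circ> \<phi>))"]) simp
qed

end
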